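(* Let $k$ be a field of characteristic different from $2$ and let $L$ be a Lie algebra over $k$. If $L$ is generated as a Lie algebra by a finite number of extremal elements, then $L$ is finite dimensional over $k$.
   Context: An element $x$ of a Lie algebra $L$ over $k$ is called extremal if $[x,[x,y]]\in kx$ for all $y\in L$. *)

theory Defs
  imports Complex_Main
begin

locale lie_algebra = vector_space scale
  for scale :: "'k::field \<Rightarrow> 'l::ab_group_add \<Rightarrow> 'l" +
  fixes bracket :: "'l \<Rightarrow> 'l \<Rightarrow> 'l"
  assumes linear_right: "Vector_Spaces.linear scale scale (\<lambda>y. bracket x y)"
    and linear_left: "Vector_Spaces.linear scale scale (\<lambda>x. bracket x y)"
    and alternating: "bracket x x = 0"
    and jacobi: "bracket x (bracket y z) + bracket y (bracket z x) + bracket z (bracket x y) = 0"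
begin

definition extremal :: "'l \<Rightarrow> bool"
  where "extremal x \<longleftrightarrow> (\<forall>y. bracket x (bracket x y) \<in> range (\<lambda>c. scale c x))"

definition lie_subalgebra :: "'l set \<Rightarrow> bool"
  where "lie_subalgebra M \<longleftrightarrow> subspace M \<and> (\<forall>x\<in>M. \<forall>y\<in>M. bracket x y \<in> M)"

definition lie_generated :: "'l set \<Rightarrow> 'l set"
  where "lie_generated S = lie_subalgebra hull S"

lemma lie_subalgebra_lie_generated: "lie_subalgebra (lie_generated S)"
  unfolding lie_generated_def
  by (rule hull_in) (auto simp: lie_subalgebra_def intro: subspace_Inter)

end

end

theory Submission
  imports Defs "HOL-Library.List_Lexorder" "HOL-Library.Sublist"
begin

text \<open>
  Filter \<open>L\<close> by the length of monomials in the extremal generators. In the associated graded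
  algebra the generators \<open>x\<close> are sandwiches: \<open>[x, [x, y]]\<close> is a multiple of \<open>x\<close>, hence shorter
  than expected, so it vanishes there. The assertion becomes the sandwich theorem of
  Kostrikin and Zel'manov, that an algebra with finitely many sandwich generators is nilpotent. The
  graded algebra itself is never constructed; its relations appear as statements modulo operators
  that raise the filtration by less than they should.

  In characteristic other than two, a sandwich \<open>b\<close> also satisfies \<open>[b, [z, [b, y]]] = 0\<close> for all
  \<open>z\<close> and \<open>y\<close>, and from this it follows that brackets of sandwiches are sandwiches
  (\<open>sandwich_middle\<close>, \<open>sandwich_bracket\<close>). So every monomial in the generators is a sandwich. By
  the usual bracketing every Lyndon word \<open>u\<close> is the lexicographically least word in the adjoint
  action of some monomial (\<open>lyndon_sandwich\<close>). Call a word normal if, as a product of adjoint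
  maps, it is not congruent to a combination of larger words of its length. The sandwich relations
  show that no normal word contains a factor \<open>u u\<close>, \<open>u y u\<close> or \<open>y u y\<close> with \<open>u\<close> Lyndon and
  \<open>y\<close> a letter.

  The heart of the proof is that over a finite alphabet only finitely many words can avoid all these
  factors (\<open>finite_sandwich_free_language\<close>). Otherwise there is a uniformly recurrent infinite
  language of such words. It has a least infinite word, and cutting that word at the first return of
  one of its prefixes gives a longer Lyndon prefix, and so on. Among these prefixes two end in the
  same letter \<open>y\<close>; removing \<open>y\<close> from the shorter of the two leaves a word \<open>f\<close> for which \<open>y f y\<close>
  occurs. This is forbidden if \<open>f\<close> is empty or Lyndon; otherwise \<open>f\<close> ends in a shorter Lyndon prefix
  \<open>u\<close> of the least word, and \<open>u y u\<close> occurs.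

  Hence for some \<open>n\<close> no word of length \<open>n\<close> is normal, every word of length \<open>n\<close> is congruent to
  zero, and monomials longer than \<open>n\<close> are combinations of shorter ones.
\<close>

section \<open>Lyndon words\<close>

lemma append_less_append_same [simp]:
  fixes x y z :: "'a::linorder list"
  shows "x @ y < x @ z \<longleftrightarrow> y < z"
  by (induction x) auto

lemma append_less_append_of_less:
  fixes x y :: "'a::linorder list"
  assumes "x < y" "length y \<le> length x"
  shows "x @ u < y @ v"
  using assms unfolding list_less_def by (rule lexord_sufI)

lemma take_mono_list:
  fixes x y :: "'a::linorder list"
  assumes "x \<le> y"
  shows "take n x \<le> take n y"
  using assms
proof (induction x arbitrary: y n)
  case (Cons a x)
  then show ?case by (cases y; cases n) auto
qed auto

text \<open>In the lexicographic order used here a proper prefix precedes the longer list.\<close>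

definition lyndon :: "'a::linorder list \<Rightarrow> bool"
  where "lyndon u \<longleftrightarrow> u \<noteq> [] \<and> (\<forall>v w. u = v @ w \<longrightarrow> v \<noteq> [] \<longrightarrow> w \<noteq> [] \<longrightarrow> u < w)"

lemma lyndon_singleton [simp]: "lyndon [a]"
  by (auto simp: lyndon_def Cons_eq_append_conv)

text \<open>The standard factorization: \<open>w\<close> is the least proper suffix of \<open>u\<close>. It is Lyndon because its
  own suffixes are suffixes of \<open>u\<close>. If \<open>v\<close> had a proper suffix \<open>s\<close> below \<open>v\<close>, then, \<open>u\<close> being
  below its suffix \<open>s @ w\<close>, this \<open>s\<close> would be a prefix of \<open>v\<close>; deleting that prefix from \<open>u\<close>
  would leave a suffix smaller than \<open>w\<close>.\<close>

lemma lyndon_factorization: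
  assumes "lyndon u" "length u \<noteq> 1"
  obtains v w where "u = v @ w" "lyndon v" "lyndon w" "u < w @ v"
proof -
  define S where "S = {w. w \<noteq> [] \<and> (\<exists>v. v \<noteq> [] \<and> u = v @ w)}"
  have fin: "finite S"
    by (rule finite_subset[of _ "set (suffixes u)"]) (auto simp: S_def suffix_def)
  obtain a u' where u: "u = a # u'" "u' \<noteq> []"
    using assms by (cases u) (auto simp: lyndon_def)
  have "u' \<in> S"
    unfolding S_def using u by (auto intro!: exI[of _ "[a]"])
  define w where "w = Min S"
  have "w \<in> S" unfolding w_def using fin \<open>u' \<in> S\<close> by (intro Min_in) auto
  have w_least: "w \<le> t" if "t \<in> S" for t
    using fin that by (simp add: w_def)
  obtain v where v: "w \<noteq> []" "v \<noteq> []" "u = v @ w" using \<open>w \<in> S\<close> by (auto simp: S_def)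
  have lyn: "u < t" if "t \<in> S" for t
    using assms(1) that by (auto simp: lyndon_def S_def)
  have "lyndon w"
    unfolding lyndon_def
  proof (intro conjI allI impI)
    fix s t assume st: "w = s @ t" "s \<noteq> []" "t \<noteq> []"
    then have "t \<in> S" using v by (auto simp: S_def intro!: exI[of _ "v @ s"])
    moreover have "w \<noteq> t" using st by auto
    ultimately show "w < t" using w_least by (simp add: less_le)
  qed (use v in auto)
  moreover have "lyndon v"
    unfolding lyndon_def
  proof (intro conjI allI impI)
    fix r s assume rs: "v = r @ s" "r \<noteq> []" "s \<noteq> []"
    then have "s @ w \<in> S" using v by (auto simp: S_def)
    then have less: "v @ w < s @ w" using lyn v by auto
    show "v < s"
    proof (rule ccontr)
      assume "\<not> v < s"
      moreover have "v \<noteq> s" using rs by auto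
      ultimately have "s < v" by auto
      then consider b t where "v = s @ b # t"
        | x b c y z where "b < c" "s = x @ b # y" "v = x @ c # z"
        unfolding list_less_def lexord_def by blast
      then show False
      proof cases
        case 1
        then have "(b # t) @ w < w" using less by simp
        moreover have "(b # t) @ w \<in> S"
          using 1 v rs by (auto simp: S_def intro!: exI[of _ s])
        ultimately show False using w_least by fastforce
      next
        case 2
        then show False using less by auto
      qed
    qed
  qed (use v in auto)
  moreover have "u < w @ v"
  proof -
    have "u < w" using lyn \<open>w \<in> S\<close> by blast
    then consider b t where "w = u @ b # t"
      | x b c y z where "b < c" "u = x @ b # y" "w = x @ c # z"
      unfolding list_less_def lexord_def by blast
    then show ?thesis
      by cases (use v in auto)
  qed
  ultimately show thesis using that v by blast
qed

section \<open>Infinite languages and recurrence\<close>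

definition factor_closed :: "'a list set \<Rightarrow> bool"
  where "factor_closed L \<longleftrightarrow> (\<forall>w\<in>L. \<forall>v. sublist v w \<longrightarrow> v \<in> L)"

lemma factor_closedD: "factor_closed L \<Longrightarrow> w \<in> L \<Longrightarrow> sublist v w \<Longrightarrow> v \<in> L"
  by (auto simp: factor_closed_def)

lemma factor_of_appends:
  assumes "factor_closed L" "a @ v @ b \<in> L"
  shows "v \<in> L"
  using factor_closedD[OF assms sublist_appendI] .

lemma infinite_language_iff:
  assumes "finite \<Sigma>" "L \<subseteq> lists \<Sigma>" "factor_closed L"
  shows "infinite L \<longleftrightarrow> (\<forall>n. \<exists>w\<in>L. length w = n)"
proof
  assume inf: "infinite L"
  show "\<forall>n. \<exists>w\<in>L. length w = n"
  proof
    fix n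
    have "\<exists>w\<in>L. n \<le> length w"
    proof (rule ccontr)
      assume "\<not> ?thesis"
      then have "L \<subseteq> {xs. set xs \<subseteq> \<Sigma> \<and> length xs \<le> n}" using assms(2) by force
      then show False using inf finite_lists_length_le[OF assms(1)] finite_subset by blast
    qed
    then obtain w where "w \<in> L" "n \<le> length w" by blast
    then show "\<exists>w\<in>L. length w = n"
      using factor_closedD[OF assms(3) _ sublist_take] by (intro bexI[of _ "take n w"]) auto
  qed
next
  assume all: "\<forall>n. \<exists>w\<in>L. length w = n"
  show "infinite L"
  proof
    assume "finite L"
    then have "finite (length ` L)" by simp
    moreover have "length ` L = UNIV" using all by (auto simp: image_iff) metis
    ultimately show False by simp
  qed
qed

text \<open>Infinitude means having words of every length, and there are finitely many words of a given
  length. So it survives intersections of chains, and Zorn's lemma applies to the complements.\<close>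

lemma minimal_infinite_language:
  assumes "finite \<Sigma>" "L \<subseteq> lists \<Sigma>" "factor_closed L" "infinite L"
  obtains K where "K \<subseteq> L" "factor_closed K" "infinite K"
    "\<And>K'. K' \<subseteq> K \<Longrightarrow> factor_closed K' \<Longrightarrow> infinite K' \<Longrightarrow> K' = K"
proof -
  define \<A> where "\<A> = {T. T \<subseteq> L \<and> factor_closed (L - T) \<and> infinite (L - T)}"
  have "\<exists>M\<in>\<A>. \<forall>T\<in>\<A>. M \<subseteq> T \<longrightarrow> T = M"
  proof (rule subset_Zorn_nonempty)
    have "{} \<in> \<A>" using assms by (simp add: \<A>_def)
    then show "\<A> \<noteq> {}" by blast
  next
    fix C assume C: "C \<noteq> {}" "subset.chain \<A> C"
    then have CA: "C \<subseteq> \<A>" by (auto simp: subset.chain_def)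
    then have fc: "factor_closed (L - \<Union>C)"
      unfolding factor_closed_def
    proof (intro ballI allI impI)
      fix w v assume w: "w \<in> L - \<Union>C" and v: "sublist v w"
      have "v \<in> L - T" if "T \<in> C" for T
        using that CA w v unfolding \<A>_def factor_closed_def by blast
      then show "v \<in> L - \<Union>C" using C(1) by blast
    qed
    have "\<exists>w\<in>L - \<Union>C. length w = n" for n
    proof (rule ccontr)
      assume none: "\<not> ?thesis"
      define W where "W = {w \<in> L. length w = n}"
      have "W \<subseteq> {xs. set xs \<subseteq> \<Sigma> \<and> length xs = n}" using assms(2) by (auto simp: W_def)
      then have "finite W" using finite_lists_length_eq[OF assms(1)] finite_subset by blast
      moreover have "W \<subseteq> \<Union>C" using none by (auto simp: W_def)
      ultimately obtain T where T: "T \<in> C" "W \<subseteq> T"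
        using finite_subset_Union_chain C by metis
      then have "factor_closed (L - T)" "infinite (L - T)" "L - T \<subseteq> lists \<Sigma>"
        using CA assms(2) by (auto simp: \<A>_def)
      then obtain w where "w \<in> L - T" "length w = n"
        using infinite_language_iff[OF assms(1)] by blast
      then show False using T by (auto simp: W_def)
    qed
    then have "infinite (L - \<Union>C)"
      using infinite_language_iff[OF assms(1) _ fc] assms(2) by blast
    then show "\<Union>C \<in> \<A>" using fc CA by (auto simp: \<A>_def)
  qed
  then obtain M where M: "M \<in> \<A>" and max: "\<And>T. T \<in> \<A> \<Longrightarrow> M \<subseteq> T \<Longrightarrow> T = M" by blast
  show thesis
  proof (rule that[of "L - M"])
    fix K' assume K': "K' \<subseteq> L - M" "factor_closed K'" "infinite K'"
    then have "L - (L - K') = K'" by blast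
    then have "L - K' = M"
      using K' M by (intro max) (auto simp: \<A>_def)
    then show "K' = L - M" using K' by blast
  qed (use M in \<open>auto simp: \<A>_def\<close>)
qed

text \<open>Minimal infinite languages are uniformly recurrent: the words that do not contain a given one
  form a smaller factor-closed language, which must be finite.\<close>

locale recurrent_language =
  fixes \<Sigma> :: "'a::linorder set" and K :: "'a list set"
  assumes alphabet: "finite \<Sigma>" "K \<subseteq> lists \<Sigma>"
    and closed: "factor_closed K"
    and infinite: "infinite K"
    and recurrent: "w \<in> K \<Longrightarrow> \<exists>n. \<forall>v\<in>K. n \<le> length v \<longrightarrow> sublist w v"
begin

text \<open>These words are prefixes of one another (\<open>take_least_word\<close>); they stand for the prefixes of
  the least infinite word of the language.\<close>

definition least_word :: "nat \<Rightarrow> 'a list"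
  where "least_word n = Min {w \<in> K. length w = n}"

lemma least_word_in: "least_word n \<in> K"
  and length_least_word [simp]: "length (least_word n) = n"
  and least_word_le: "w \<in> K \<Longrightarrow> length w = n \<Longrightarrow> least_word n \<le> w"
proof -
  have "{w \<in> K. length w = n} \<subseteq> {xs. set xs \<subseteq> \<Sigma> \<and> length xs = n}"
    using alphabet(2) by auto
  then have fin: "finite {w \<in> K. length w = n}"
    using finite_lists_length_eq[OF alphabet(1)] finite_subset by blast
  moreover have "{w \<in> K. length w = n} \<noteq> {}"
    using infinite_language_iff[OF alphabet closed] infinite by blast
  ultimately have "least_word n \<in> {w \<in> K. length w = n}"
    unfolding least_word_def by (rule Min_in)
  then show "least_word n \<in> K" "length (least_word n) = n" by auto
  show "least_word n \<le> w" if "w \<in> K" "length w = n"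
    unfolding least_word_def using fin that by (intro Min_le) auto
qed

text \<open>By recurrence \<open>w\<close> occurs early in any sufficiently long word.\<close>

lemma right_extension:
  assumes "w \<in> K" "length w \<le> n"
  obtains v where "v \<in> K" "length v = n" "take (length w) v = w"
proof -
  obtain N where N: "\<And>v. v \<in> K \<Longrightarrow> N \<le> length v \<Longrightarrow> sublist w v"
    using recurrent[OF assms(1)] by blast
  let ?u = "least_word (N + n)"
  have "take N ?u \<in> K" using factor_closedD[OF closed least_word_in sublist_take] .
  then obtain a b where ab: "take N ?u = a @ w @ b"
    using N[of "take N ?u"] by (auto simp: sublist_def)
  then have "?u = a @ (w @ b @ drop N ?u) @ []" by (metis append_take_drop_id append.assoc append_Nil2)
  then have "w @ b @ drop N ?u \<in> K"
    using factor_of_appends[OF closed] least_word_in by metis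
  then have "take n (w @ b @ drop N ?u) \<in> K"
    using factor_closedD[OF closed _ sublist_take] by blast
  moreover have "length (take n (w @ b @ drop N ?u)) = n"
    by (simp only: length_take length_append length_drop length_least_word)
  moreover have "take (length w) (take n (w @ b @ drop N ?u)) = w"
    using assms(2) by (simp only: take_take min_absorb1) simp
  ultimately show thesis by (rule that)
qed

lemma take_least_word:
  assumes "k \<le> n"
  shows "take k (least_word n) = least_word k"
proof (rule antisym)
  obtain v where v: "v \<in> K" "length v = n" "take k v = least_word k"
    using right_extension[OF least_word_in, of k n] assms by auto
  then show "take k (least_word n) \<le> least_word k"
    using take_mono_list[OF least_word_le[OF v(1,2)], of k] by simp
  show "least_word k \<le> take k (least_word n)"
    using assms factor_closedD[OF closed least_word_in sublist_take] by (intro least_word_le) auto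
qed

text \<open>A suffix of length \<open>l\<close> is at least the least word of length \<open>l\<close>, which is a prefix.
  Without borders it is strictly larger.\<close>

lemma lyndon_if_unbordered:
  assumes "0 < k" and unbordered: "\<And>l. 0 < l \<Longrightarrow> l < k \<Longrightarrow> \<not> suffix (least_word l) (least_word k)"
  shows "lyndon (least_word k)"
  unfolding lyndon_def
proof (intro conjI allI impI)
  show "least_word k \<noteq> []" using assms(1) length_least_word[of k] by force
  fix v w assume vw: "least_word k = v @ w" "v \<noteq> []" "w \<noteq> []"
  let ?l = "length w"
  have l: "0 < ?l" "?l < k" using vw length_least_word[of k] by auto
  have "w \<in> K" using factor_of_appends[OF closed, of v w "[]"] vw least_word_in[of k] by simp
  then have "least_word ?l \<le> w" by (simp add: least_word_le)
  moreover have "least_word ?l \<noteq> w" using unbordered[OF l] vw by (auto simp: suffix_def)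
  ultimately have "least_word ?l < w" by simp
  then have "least_word ?l @ drop ?l (least_word k) < w @ []"
    by (rule append_less_append_of_less) simp
  then show "least_word k < w"
    using take_least_word[of ?l k] l by (metis append_Nil2 append_take_drop_id less_imp_le)
qed

text \<open>The shortest border has no borders itself.\<close>

lemma lyndon_border:
  assumes "0 < k" "\<not> lyndon (least_word k)"
  obtains l where "0 < l" "l < k" "lyndon (least_word l)" "suffix (least_word l) (least_word k)"
proof -
  define P where "P l \<longleftrightarrow> 0 < l \<and> l < k \<and> suffix (least_word l) (least_word k)" for l
  have "\<exists>l. P l" using lyndon_if_unbordered assms unfolding P_def by blast
  then have l: "P (LEAST l. P l)" by (rule LeastI_ex)
  have "lyndon (least_word (LEAST l. P l))"
  proof (rule lyndon_if_unbordered)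
    fix i assume i: "0 < i" "i < (LEAST l. P l)"
    then show "\<not> suffix (least_word i) (least_word (LEAST l. P l))"
      using not_less_Least[OF i(2)] l suffix_order.trans unfolding P_def by fastforce
  qed (use l in \<open>simp add: P_def\<close>)
  then show thesis using that l unfolding P_def by blast
qed

lemma lyndon_unbordered:
  assumes "lyndon (least_word k)" "0 < l" "l < k"
  shows "\<not> suffix (least_word l) (least_word k)"
proof
  assume "suffix (least_word l) (least_word k)"
  then obtain v where v: "least_word k = v @ least_word l" by (auto simp: suffix_def)
  then have "v \<noteq> []" "least_word l \<noteq> []" using assms length_least_word by (metis append_Nil nat_neq_iff, metis length_0_conv less_irrefl length_least_word)
  then have "least_word k < least_word l" using assms(1) v unfolding lyndon_def by blast
  moreover have "least_word l \<le> least_word k"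
    using take_least_word[of l k] assms(3)
    by (metis append_Nil2 append_less_append_same append_take_drop_id less_imp_le linorder_not_less not_less_Nil)
  ultimately show False by simp
qed

section \<open>Returns of Lyndon prefixes\<close>

text \<open>The first positive position at which the prefix of length \<open>k\<close> of the least infinite word
  occurs again.\<close>

definition first_return :: "nat \<Rightarrow> nat"
  where "first_return k = (LEAST j. 0 < j \<and> least_word (j + k) = least_word j @ least_word k)"

lemma first_return: "0 < first_return k \<and>
    least_word (first_return k + k) = least_word (first_return k) @ least_word k"
  unfolding first_return_def
proof (rule LeastI_ex)
  obtain N where N: "\<And>v. v \<in> K \<Longrightarrow> N \<le> length v \<Longrightarrow> sublist (least_word k) v"
    using recurrent[OF least_word_in] by blast
  obtain x u where xu: "least_word (Suc N) = x # u"
    by (metis length_least_word length_Suc_conv)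
  then have "[x] @ u @ [] \<in> K" using least_word_in[of "Suc N"] by simp
  then have "u \<in> K" by (rule factor_of_appends[OF closed])
  moreover have "length u = N" using xu length_least_word[of "Suc N"] by simp
  ultimately have "sublist (least_word k) u" using N by simp
  then obtain a b where u: "u = a @ least_word k @ b" by (auto simp: sublist_def)
  let ?j = "Suc (length a)"
  have le: "?j + k \<le> Suc N" using u \<open>length u = N\<close> by auto
  have "least_word (?j + k) = x # a @ least_word k"
    using take_least_word[OF le] xu u by simp
  moreover have "least_word ?j = x # a"
    using take_least_word[of ?j "Suc N"] le xu u by simp
  ultimately show "\<exists>j>0. least_word (j + k) = least_word j @ least_word k"
    by (intro exI[of _ ?j]) simp
qed

lemma first_return_least:
  assumes "0 < j" "j + k \<le> n" "take (j + k) (least_word n) = v @ least_word k"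
  shows "first_return k \<le> j"
proof -
  have eq: "least_word (j + k) = v @ least_word k" using take_least_word[OF assms(2)] assms(3) by simp
  then have "length v = j" using length_least_word[of "j + k"] by simp
  then have "v = least_word j" using eq take_least_word[of j "j + k"] by simp
  then show ?thesis unfolding first_return_def using assms(1) eq by (intro Least_le) simp
qed

lemma first_return_ge:
  assumes "lyndon (least_word k)"
  shows "k \<le> first_return k"
proof (rule ccontr)
  assume "\<not> ?thesis"
  then have j: "first_return k < k" by simp
  let ?j = "first_return k"
  have "least_word k = take k (least_word (?j + k))" by (simp add: take_least_word)
  also have "\<dots> = least_word ?j @ least_word (k - ?j)"
    using first_return[of k] j by (simp add: take_least_word)
  finally show False
    using lyndon_unbordered[OF assms, of "k - ?j"] first_return[of k] j by (auto simp: suffix_def)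
qed

text \<open>Take the shortest border \<open>u\<close> of the prefix up to the first return of \<open>p\<close>, where \<open>p\<close> is the
  prefix of length \<open>k\<close>. If \<open>u\<close> is at least as long as \<open>p\<close>, it starts with an earlier return of \<open>p\<close>;
  if it is shorter, the copy of \<open>p\<close> that follows starts with \<open>u\<close>, which makes a square.\<close>

lemma lyndon_first_return:
  assumes "lyndon (least_word k)" and sq: "\<And>u. lyndon u \<Longrightarrow> u @ u \<notin> K"
  shows "lyndon (least_word (first_return k))"
proof (rule ccontr)
  let ?j = "first_return k"
  assume "\<not> ?thesis"
  then obtain l where l: "0 < l" "l < ?j" "lyndon (least_word l)" "suffix (least_word l) (least_word ?j)"
    using lyndon_border first_return by blast
  then obtain v where v: "least_word ?j = v @ least_word l" by (auto simp: suffix_def)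
  have lv: "length v = ?j - l" using arg_cong[OF v, of length] by simp
  show False
  proof (cases "k \<le> l")
    case True
    have "take (?j - l + k) (least_word ?j) = v @ least_word k"
      using v lv True l by (simp add: take_least_word)
    then have "?j \<le> ?j - l"
      using first_return_least[of "?j - l" k ?j] l True by simp
    then show False using l by simp
  next
    case False
    then have "least_word k = least_word l @ drop l (least_word k)"
      using take_least_word[of l k] by (metis append_take_drop_id linorder_not_le less_imp_le)
    then have "least_word (?j + k) = v @ (least_word l @ least_word l) @ drop l (least_word k)"
      using first_return[of k] v by (metis append.assoc)
    then have "least_word l @ least_word l \<in> K"
      using factor_of_appends[OF closed] least_word_in by metis
    then show False using sq l by blast
  qed
qed

text \<open>Iterating the first return from the first letter gives Lyndon prefixes of lengths \<open>k 0\<close>,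
  \<open>k 1\<close>, and so on. Two of them, after the first, end in the same letter \<open>y\<close>. The shorter one is
  \<open>f\<close> followed by \<open>y\<close>; a later return of a prefix beginning with it comes directly after
  another \<open>y\<close>, so \<open>y f y\<close> occurs.\<close>

lemma no_sandwich_free_recurrent_language:
  assumes sq: "\<And>u. lyndon u \<Longrightarrow> u @ u \<notin> K"
    and inner: "\<And>u y. lyndon u \<Longrightarrow> u @ [y] @ u \<notin> K"
    and outer: "\<And>u y. lyndon u \<Longrightarrow> [y] @ u @ [y] \<notin> K"
  shows False
proof -
  define k where "k i = (first_return ^^ i) 1" for i
  have k_Suc: "k (Suc i) = first_return (k i)" for i by (simp add: k_def)
  have lyn: "lyndon (least_word (k i))" for i
  proof (induction i)
    case 0
    obtain a where "least_word 1 = [a]" using length_least_word[of 1] by (metis One_nat_def length_0_conv length_Suc_conv)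
    then show ?case by (simp add: k_def)
  qed (simp add: k_Suc lyndon_first_return sq)
  have k_pos: "0 < k i" for i
    using lyn[of i] length_least_word[of "k i"] unfolding lyndon_def by (metis length_greater_0_conv)
  have mono: "k i \<le> k i'" if "i \<le> i'" for i i'
    using that by (rule lift_Suc_mono_le[rotated]) (simp add: k_Suc first_return_ge lyn)
  have split: "least_word (k i) = least_word (k i - 1) @ [last (least_word (k i))]" for i
    using take_least_word[of "k i - 1" "k i"] k_pos[of i]
    by (metis append_butlast_last_id butlast_conv_take diff_le_self length_least_word length_greater_0_conv)
  have "range (\<lambda>i. last (least_word (k (Suc i)))) \<subseteq> \<Sigma>"
  proof
    fix y assume "y \<in> range (\<lambda>i. last (least_word (k (Suc i))))"
    then obtain i where "y = last (least_word (k (Suc i)))" by blast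
    then have "y \<in> set (least_word (k (Suc i)))" using split[of "Suc i"] by (metis in_set_conv_decomp)
    then show "y \<in> \<Sigma>" using alphabet(2) least_word_in by blast
  qed
  then have "\<not> inj (\<lambda>i. last (least_word (k (Suc i))))"
    using alphabet(1) finite_imageD[of _ UNIV] finite_subset infinite_UNIV_nat by blast
  then obtain i i' where i: "i < i'"
      and same: "last (least_word (k (Suc i))) = last (least_word (k (Suc i')))"
    unfolding inj_def by (metis linorder_neqE_nat)
  define y where "y = last (least_word (k (Suc i)))"
  define f where "f = k (Suc i) - 1"
  have end_i: "least_word (k (Suc i)) = least_word f @ [y]"
    using split[of "Suc i"] by (simp add: f_def y_def)
  have "k (Suc i) \<le> k i'" using i by (intro mono) simp
  then have "least_word (k i') = least_word (k (Suc i)) @ drop (k (Suc i)) (least_word (k i'))"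
    using take_least_word by (metis append_take_drop_id)
  then have "least_word (k (Suc i') + k i') = least_word (k (Suc i') - 1) @ ([y] @ least_word f @ [y])
      @ drop (k (Suc i)) (least_word (k i'))"
    using first_return[of "k i'"] split[of "Suc i'"] same end_i by (simp add: k_Suc y_def)
  then have yfy: "[y] @ least_word f @ [y] \<in> K"
    using factor_of_appends[OF closed] least_word_in by metis
  have ret: "least_word (k (Suc i) + k i) = least_word f @ [y] @ least_word (k i)"
    using first_return[of "k i"] end_i by (simp add: k_Suc)
  show False
  proof (cases "f = 0")
    case True
    then have "least_word f = []" by (metis length_0_conv length_least_word)
    then have "[y] @ [y] \<in> K" using yfy by simp
    then show False using sq[of "[y]"] by simp
  next
    case False
    \<comment> \<open>The shortest border of \<open>f\<close> plays the same role as in \<open>lyndon_first_return\<close>, but now the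
      letter \<open>y\<close> separates it from the returning prefix.\<close>
    have "\<not> lyndon (least_word f)" using yfy outer by blast
    then obtain l where l: "0 < l" "l < f" "lyndon (least_word l)" "suffix (least_word l) (least_word f)"
      using lyndon_border False by blast
    then obtain v where v: "least_word f = v @ least_word l" by (auto simp: suffix_def)
    have lv: "length v = f - l" using arg_cong[OF v, of length] by simp
    show False
    proof (cases "l \<le> k i")
      case True
      then have "least_word (k i) = least_word l @ drop l (least_word (k i))"
        using take_least_word by (metis append_take_drop_id)
      then have "least_word (k (Suc i) + k i) = v @ (least_word l @ [y] @ least_word l) @ drop l (least_word (k i))"
        using ret v by (metis append.assoc)
      then have "least_word l @ [y] @ least_word l \<in> K"
        using factor_of_appends[OF closed] least_word_in by metis
      then show False using inner l by blast
    next
      case False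
      have "take (f - l + k i) (least_word f) = v @ least_word (k i)"
        using v lv False by (simp add: take_least_word)
      then have "k (Suc i) \<le> f - l"
        using first_return_least[of "f - l" "k i" f] l False by (simp add: k_Suc)
      then show False using l f_def by simp
    qed
  qed
qed

end

theorem finite_sandwich_free_language:
  fixes L :: "'a::linorder list set"
  assumes "finite \<Sigma>" "L \<subseteq> lists \<Sigma>" "factor_closed L"
    and sq: "\<And>u. lyndon u \<Longrightarrow> u @ u \<notin> L"
    and inner: "\<And>u y. lyndon u \<Longrightarrow> u @ [y] @ u \<notin> L"
    and outer: "\<And>u y. lyndon u \<Longrightarrow> [y] @ u @ [y] \<notin> L"
  shows "finite L"
proof (rule ccontr)
  assume "infinite L"
  then obtain K where K: "K \<subseteq> L" "factor_closed K" "infinite K"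
    and min: "\<And>K'. K' \<subseteq> K \<Longrightarrow> factor_closed K' \<Longrightarrow> infinite K' \<Longrightarrow> K' = K"
    using minimal_infinite_language[OF assms(1-3)] by blast
  interpret recurrent_language \<Sigma> K
  proof
    fix w assume w: "w \<in> K"
    let ?K' = "{v \<in> K. \<not> sublist w v}"
    have "factor_closed ?K'"
      using K(2) sublist_order.order_trans unfolding factor_closed_def by blast
    then have "finite ?K'" using min[of ?K'] w by blast
    then obtain n where "\<forall>v\<in>?K'. length v < n"
      using finite_nat_set_iff_bounded[of "length ` ?K'"] by auto
    then show "\<exists>n. \<forall>v\<in>K. n \<le> length v \<longrightarrow> sublist w v"
      by (metis (mono_tags, lifting) linorder_not_le mem_Collect_eq)
  qed (use assms K in auto)
  show False
    using no_sandwich_free_recurrent_language K(1) sq inner outer by blast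
qed

section \<open>Brackets\<close>

context lie_algebra
begin

lemma bracket_add_right: "bracket x (y + z) = bracket x y + bracket x z"
  and bracket_scale_right: "bracket x (scale c y) = scale c (bracket x y)"
  and bracket_diff_right: "bracket x (y - z) = bracket x y - bracket x z"
  and bracket_zero_right: "bracket x 0 = 0"
proof -
  interpret R: Vector_Spaces.linear scale scale "bracket x" by (rule linear_right)
  show "bracket x (y + z) = bracket x y + bracket x z" "bracket x (scale c y) = scale c (bracket x y)"
    "bracket x (y - z) = bracket x y - bracket x z" "bracket x 0 = 0"
    by (fact R.add R.scale R.diff R.zero)+
qed

lemma bracket_add_left: "bracket (x + y) z = bracket x z + bracket y z"
  and bracket_scale_left: "bracket (scale c x) z = scale c (bracket x z)"
  and bracket_zero_left: "bracket 0 z = 0"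
proof -
  interpret R: Vector_Spaces.linear scale scale "\<lambda>x. bracket x z" by (rule linear_left)
  show "bracket (x + y) z = bracket x z + bracket y z"
    "bracket (scale c x) z = scale c (bracket x z)" "bracket 0 z = 0"
    by (fact R.add R.scale R.zero)+
qed

lemma bracket_minus: "bracket y x = - bracket x y"
proof -
  have "bracket x y + bracket y x = 0"
    using alternating[of "x + y", unfolded bracket_add_left bracket_add_right]
    by (simp add: alternating add.commute)
  then show ?thesis using minus_unique by metis
qed

lemma bracket_bracket: "bracket (bracket x y) z = bracket x (bracket y z) - bracket y (bracket x z)"
proof -
  have "bracket x (bracket y z) + bracket y (bracket z x) + bracket z (bracket x y) = 0"
    by (rule jacobi)
  moreover have "bracket z (bracket x y) = - bracket (bracket x y) z" by (rule bracket_minus)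
  moreover have "bracket y (bracket z x) = - bracket y (bracket x z)"
    using bracket_diff_right[of y 0 "bracket x z"] bracket_minus[of z x] by (simp add: bracket_zero_right)
  ultimately show ?thesis by (simp add: algebra_simps)
qed

lemma subspace_bracket_right_preimage: "subspace V \<Longrightarrow> subspace {x. bracket y x \<in> V}"
  by (rule subspaceI)
    (auto simp: bracket_zero_right bracket_add_right bracket_scale_right
      intro: subspace_0 subspace_add subspace_scale)

lemma subspace_bracket_left_preimage: "subspace V \<Longrightarrow> subspace {x. bracket x y \<in> V}"
  by (rule subspaceI)
    (auto simp: bracket_zero_left bracket_add_left bracket_scale_left
      intro: subspace_0 subspace_add subspace_scale)

end

section \<open>The length filtration\<close>

text \<open>The generators are indexed by natural numbers, so that words in them are ordered
  lexicographically.\<close>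

locale extremal_generators = lie_algebra scale bracket
  for scale :: "'k::field \<Rightarrow> 'l::ab_group_add \<Rightarrow> 'l" and bracket :: "'l \<Rightarrow> 'l \<Rightarrow> 'l" +
  fixes e :: "nat \<Rightarrow> 'l" and m :: nat
  assumes two_nonzero: "(2::'k) \<noteq> 0"
    and extremal_generator: "i < m \<Longrightarrow> extremal (e i)"
begin

abbreviation words :: "nat list set"
  where "words \<equiv> lists {..<m}"

primrec word_ad :: "nat list \<Rightarrow> 'l \<Rightarrow> 'l"
  where
    "word_ad [] x = x"
  | "word_ad (i # w) x = bracket (e i) (word_ad w x)"

lemma word_ad_append: "word_ad (v @ w) x = word_ad v (word_ad w x)"
  by (induction v) auto

lemma word_ad_add: "word_ad w (x + y) = word_ad w x + word_ad w y"
  by (induction w) (auto simp: bracket_add_right)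

lemma word_ad_scale: "word_ad w (scale c x) = scale c (word_ad w x)"
  by (induction w) (auto simp: bracket_scale_right)

text \<open>The elements expressible by left-normed monomials of length at most \<open>d\<close>; the length of
  \<open>word_ad w (e i)\<close> is one more than that of \<open>w\<close>.\<close>

definition filt :: "nat \<Rightarrow> 'l set"
  where "filt d = span {word_ad w (e i) | w i. w \<in> words \<and> i < m \<and> length w < d}"

lemma subspace_filt: "subspace (filt d)"
  by (simp add: filt_def)

lemmas filt_zero = subspace_0[OF subspace_filt]
  and filt_add = subspace_add[OF subspace_filt]
  and filt_diff = subspace_diff[OF subspace_filt]
  and filt_scale = subspace_scale[OF subspace_filt]

lemma filt_mono: "c \<le> d \<Longrightarrow> filt c \<subseteq> filt d"
  unfolding filt_def by (rule span_mono) force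

lemma word_in_filt: "w \<in> words \<Longrightarrow> i < m \<Longrightarrow> length w < d \<Longrightarrow> word_ad w (e i) \<in> filt d"
  unfolding filt_def by (rule span_base) blast

lemma filt_induct [consumes 1, case_names subspace word]:
  assumes "x \<in> filt d" "subspace {x. P x}"
    and "\<And>w i. w \<in> words \<Longrightarrow> i < m \<Longrightarrow> length w < d \<Longrightarrow> P (word_ad w (e i))"
  shows "P x"
  using assms(1,2) unfolding filt_def by (rule span_induct) (use assms(3) in blast)

lemma generator_bracket_filt:
  assumes "i < m" "x \<in> filt d"
  shows "bracket (e i) x \<in> filt (Suc d)"
  using assms(2)
proof (induction rule: filt_induct)
  case subspace
  show ?case by (rule subspace_bracket_right_preimage) (rule subspace_filt)
next
  case (word w j)
  then show ?case using word_in_filt[of "i # w" j "Suc d"] assms(1) by simp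
qed

lemma word_ad_filt:
  assumes "w \<in> words" "x \<in> filt d"
  shows "word_ad w x \<in> filt (d + length w)"
  using assms(1) by (induction w) (use assms(2) generator_bracket_filt in auto)

lemma word_bracket_filt:
  assumes "w \<in> words" "i < m" "y \<in> filt d"
  shows "bracket (word_ad w (e i)) y \<in> filt (Suc (length w) + d)"
  using assms(1,3)
proof (induction w arbitrary: y d)
  case Nil
  then show ?case using generator_bracket_filt assms(2) by simp
next
  case (Cons j w)
  then have j: "j < m" and w: "w \<in> words" by auto
  have "bracket (e j) (bracket (word_ad w (e i)) y) \<in> filt (Suc (Suc (length w) + d))"
    using Cons generator_bracket_filt[OF j] by blast
  moreover have "bracket (word_ad w (e i)) (bracket (e j) y) \<in> filt (Suc (length w) + Suc d)"
    using Cons generator_bracket_filt[OF j] by blast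
  ultimately show ?case by (simp add: bracket_bracket filt_diff)
qed

text \<open>Left-normed monomials span: the Jacobi identity rewrites the adjoint action of a monomial
  of length \<open>n\<close> as a combination of words of length \<open>n\<close> in the adjoint actions of generators.\<close>

lemma bracket_filt:
  assumes "x \<in> filt c" "y \<in> filt d"
  shows "bracket x y \<in> filt (c + d)"
  using assms(1)
proof (induction rule: filt_induct)
  case subspace
  show ?case by (rule subspace_bracket_left_preimage) (rule subspace_filt)
next
  case (word w i)
  then show ?case
    using word_bracket_filt[OF _ _ assms(2)] filt_mono[of "Suc (length w) + d" "c + d"] by auto
qed

text \<open>An operator that should raise length by \<open>n\<close> but raises it by \<open>n - 1\<close> only: an operator of
  degree \<open>n\<close> that vanishes on the associated graded algebra. Starting at \<open>filt (Suc d)\<close> leaves the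
  zero space \<open>filt 0\<close> unconstrained and avoids a subtraction.\<close>

definition low :: "nat \<Rightarrow> ('l \<Rightarrow> 'l) set"
  where "low n = {T. \<forall>d. \<forall>x\<in>filt (Suc d). T x \<in> filt (d + n)}"

lemma lowI: "(\<And>d x. x \<in> filt (Suc d) \<Longrightarrow> T x \<in> filt (d + n)) \<Longrightarrow> T \<in> low n"
  by (simp add: low_def)

lemma lowD: "T \<in> low n \<Longrightarrow> x \<in> filt (Suc d) \<Longrightarrow> T x \<in> filt (d + n)"
  by (simp add: low_def)

lemma low_zero: "(\<lambda>x. 0) \<in> low n"
  and low_add: "S \<in> low n \<Longrightarrow> T \<in> low n \<Longrightarrow> (\<lambda>x. S x + T x) \<in> low n"
  and low_diff: "S \<in> low n \<Longrightarrow> T \<in> low n \<Longrightarrow> (\<lambda>x. S x - T x) \<in> low n"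
  and low_scale: "T \<in> low n \<Longrightarrow> (\<lambda>x. scale c (T x)) \<in> low n"
  by (simp_all add: low_def filt_zero filt_add filt_diff filt_scale)

lemma low_comp_left:
  assumes "T \<in> low n" "\<And>d x. x \<in> filt d \<Longrightarrow> S x \<in> filt (d + k)"
  shows "(\<lambda>x. S (T x)) \<in> low (k + n)"
proof (rule lowI)
  fix d x assume "x \<in> filt (Suc d)"
  then show "S (T x) \<in> filt (d + (k + n))"
    using assms(2)[OF lowD[OF assms(1)]] by (simp add: ac_simps)
qed

lemma low_comp_right:
  assumes "S \<in> low n" "\<And>d x. x \<in> filt (Suc d) \<Longrightarrow> T x \<in> filt (Suc (d + k))"
  shows "(\<lambda>x. S (T x)) \<in> low (n + k)"
proof (rule lowI)
  fix d x assume "x \<in> filt (Suc d)"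
  then show "S (T x) \<in> filt (d + (n + k))"
    using lowD[OF assms(1) assms(2)] by (simp add: ac_simps)
qed

section \<open>Sandwiches modulo shorter elements\<close>

text \<open>The symbol of \<open>b\<close> in degree \<open>r\<close> of the associated graded Lie algebra has adjoint square
  zero.\<close>

definition sandwich :: "nat \<Rightarrow> 'l \<Rightarrow> bool"
  where "sandwich r b \<longleftrightarrow> b \<in> filt r \<and> (\<lambda>x. bracket b (bracket b x)) \<in> low (2 * r)"

text \<open>An extremal element becomes a sandwich: \<open>[x, [x, y]]\<close> is a multiple of \<open>x\<close>, of length one,
  whereas length at least three is expected of it.\<close>

lemma sandwich_generator:
  assumes "i < m"
  shows "sandwich 1 (e i)"
  unfolding sandwich_def
proof
  show mem: "e i \<in> filt 1" using word_in_filt[of "[]" i 1] assms by simp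
  show "(\<lambda>x. bracket (e i) (bracket (e i) x)) \<in> low (2 * 1)"
  proof (rule lowI)
    fix d x assume "x \<in> filt (Suc d)"
    obtain c where "bracket (e i) (bracket (e i) x) = scale c (e i)"
      using extremal_generator[OF assms] by (auto simp: extremal_def)
    then show "bracket (e i) (bracket (e i) x) \<in> filt (d + 2 * 1)"
      using filt_scale[OF mem] filt_mono[of 1 "d + 2 * 1"] by auto
  qed
qed

lemma bracket_filt_Suc:
  "b \<in> filt r \<Longrightarrow> x \<in> filt d \<Longrightarrow> bracket b x \<in> filt (d + r)"
  "b \<in> filt r \<Longrightarrow> x \<in> filt (Suc d) \<Longrightarrow> bracket b x \<in> filt (Suc (d + r))"
  using bracket_filt[of b r x d] bracket_filt[of b r x "Suc d"] by (simp_all add: ac_simps)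

text \<open>Writing \<open>B\<close> and \<open>Z\<close> for the adjoint maps of \<open>b\<close> and \<open>z\<close>, the adjoint map of
  \<open>[b, [b, z]]\<close> is \<open>B\<^sup>2 Z - 2 B Z B + Z B\<^sup>2\<close>. All terms except the middle one are low, so
  twice \<open>B Z B\<close> is low; here the characteristic enters.\<close>

lemma sandwich_middle:
  assumes b: "sandwich r b" and z: "z \<in> filt s" "0 < s"
  shows "(\<lambda>x. bracket b (bracket z (bracket b x))) \<in> low (2 * r + s)"
proof (rule lowI)
  obtain s' where s': "s = Suc s'" using z(2) by (cases s) auto
  have bb: "(\<lambda>x. bracket b (bracket b x)) \<in> low (2 * r)" using b by (simp add: sandwich_def)
  fix d x assume x: "x \<in> filt (Suc d)"
  let ?V = "filt (d + (2 * r + s))"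
  have "bracket b (bracket b (bracket z x)) \<in> ?V"
    using lowD[OF low_comp_right[OF bb bracket_filt_Suc(2)[OF z(1)]] x] by (simp add: ac_simps)
  moreover have "bracket z (bracket b (bracket b x)) \<in> ?V"
    using lowD[OF low_comp_left[OF bb bracket_filt_Suc(1)[OF z(1)]] x] by (simp add: ac_simps)
  moreover have "bracket (bracket b (bracket b z)) x \<in> ?V"
    using bracket_filt[OF lowD[OF bb z(1)[unfolded s']] x] by (simp add: s' ac_simps)
  moreover have "bracket b (bracket z (bracket b x)) + bracket b (bracket z (bracket b x))
      = bracket b (bracket b (bracket z x)) + bracket z (bracket b (bracket b x))
        - bracket (bracket b (bracket b z)) x"
    by (simp add: bracket_bracket bracket_diff_right)
  ultimately have "bracket b (bracket z (bracket b x)) + bracket b (bracket z (bracket b x)) \<in> ?V"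
    by (simp add: filt_add filt_diff)
  then have "scale (1/2) (scale 2 (bracket b (bracket z (bracket b x)))) \<in> ?V"
    using filt_scale scale_left_distrib[of 1 1] by (metis one_add_one scale_one)
  then show "bracket b (bracket z (bracket b x)) \<in> ?V"
    using two_nonzero by simp
qed

text \<open>The square of \<open>B C - C B\<close> has the four terms \<open>B C B C\<close>, \<open>C B C B\<close>, \<open>B C\<^sup>2 B\<close> and
  \<open>C B\<^sup>2 C\<close>, each of which contains a low factor.\<close>

lemma sandwich_bracket:
  assumes b: "sandwich r b" and c: "sandwich s c" and "0 < r" "0 < s"
  shows "sandwich (r + s) (bracket b c)"
  unfolding sandwich_def
proof
  have mem: "b \<in> filt r" "c \<in> filt s"
    and sq: "(\<lambda>x. bracket b (bracket b x)) \<in> low (2 * r)" "(\<lambda>x. bracket c (bracket c x)) \<in> low (2 * s)"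
    using b c by (auto simp: sandwich_def)
  show "bracket b c \<in> filt (r + s)" using mem by (rule bracket_filt)
  note right = low_comp_right[OF _ bracket_filt_Suc(2)] and left = low_comp_left[OF _ bracket_filt_Suc(1)]
  have "(\<lambda>x. bracket b (bracket c (bracket b (bracket c x)))) \<in> low (2 * (r + s))"
    using right[OF sandwich_middle[OF b mem(2) assms(4)] mem(2)] by (simp add: algebra_simps)
  moreover have "(\<lambda>x. bracket c (bracket b (bracket c (bracket b x)))) \<in> low (2 * (r + s))"
    using right[OF sandwich_middle[OF c mem(1) assms(3)] mem(1)] by (simp add: algebra_simps)
  moreover have "(\<lambda>x. bracket b (bracket c (bracket c (bracket b x)))) \<in> low (2 * (r + s))"
    using right[OF left[OF sq(2) mem(1)] mem(1)] by (simp add: algebra_simps)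
  moreover have "(\<lambda>x. bracket c (bracket b (bracket b (bracket c x)))) \<in> low (2 * (r + s))"
    using right[OF left[OF sq(1) mem(2)] mem(2)] by (simp add: algebra_simps)
  moreover have "bracket (bracket b c) (bracket (bracket b c) x)
      = (bracket b (bracket c (bracket b (bracket c x))) + bracket c (bracket b (bracket c (bracket b x))))
      - (bracket b (bracket c (bracket c (bracket b x))) + bracket c (bracket b (bracket b (bracket c x))))" for x
    by (simp add: bracket_bracket bracket_diff_right)
  ultimately show "(\<lambda>x. bracket (bracket b c) (bracket (bracket b c) x)) \<in> low (2 * (r + s))"
    by (simp add: low_add low_diff)
qed

section \<open>Leading words of operators\<close>

text \<open>The span, modulo low operators, of the words of the same length that are lexicographically
  larger than \<open>w\<close>.\<close>

inductive_set above :: "nat list \<Rightarrow> ('l \<Rightarrow> 'l) set" for w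
  where
    low: "T \<in> low (length w) \<Longrightarrow> T \<in> above w"
  | word: "v \<in> words \<Longrightarrow> length v = length w \<Longrightarrow> w < v \<Longrightarrow> word_ad v \<in> above w"
  | add: "S \<in> above w \<Longrightarrow> T \<in> above w \<Longrightarrow> (\<lambda>x. S x + T x) \<in> above w"
  | scale: "T \<in> above w \<Longrightarrow> (\<lambda>x. scale c (T x)) \<in> above w"

lemma above_diff:
  assumes "S \<in> above w" "T \<in> above w"
  shows "(\<lambda>x. S x - T x) \<in> above w"
  using above.add[OF assms(1) above.scale[OF assms(2), of "-1"]] by simp

lemma above_antimono:
  assumes "T \<in> above v" "w < v" "length v = length w"
  shows "T \<in> above w"
  using assms(1)
proof induction
  case (word u)
  then show ?case using assms by (intro above.word) auto
qed (use assms(3) in \<open>auto intro: above.low above.add above.scale\<close>)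

lemma above_comp_word_left:
  assumes "T \<in> above w" "v \<in> words"
  shows "(\<lambda>x. word_ad v (T x)) \<in> above (v @ w)"
  using assms(1)
proof induction
  case (low T)
  have "(\<lambda>x. word_ad v (T x)) \<in> low (length v + length w)"
    using low word_ad_filt[OF assms(2)] by (rule low_comp_left)
  then show ?case by (intro above.low) simp
next
  case (word u)
  then have "word_ad (v @ u) \<in> above (v @ w)" using assms(2) by (intro above.word) auto
  then show ?case by (simp add: word_ad_append[abs_def])
next
  case (add S T)
  then show ?case using above.add by (simp add: word_ad_add)
next
  case (scale T c)
  then show ?case using above.scale by (simp add: word_ad_scale)
qed

definition leads :: "('l \<Rightarrow> 'l) \<Rightarrow> nat list \<Rightarrow> bool"
  where "leads T w \<longleftrightarrow> (\<lambda>x. T x - word_ad w x) \<in> above w"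

lemma leads_word_ad: "leads (word_ad w) w"
  unfolding leads_def using low_zero by (simp add: above.low)

lemma leads_generator: "leads (bracket (e i)) [i]"
  using leads_word_ad[of "[i]"] by (simp add: leads_def)

lemma above_filt:
  assumes "T \<in> above w" "x \<in> filt (Suc d)"
  shows "T x \<in> filt (Suc (d + length w))"
  using assms(1)
proof induction
  case (low T)
  then show ?case using lowD[OF low assms(2)] filt_mono[of "d + length w" "Suc (d + length w)"] by auto
next
  case (word v)
  then show ?case using word_ad_filt[OF word(1) assms(2)] by simp
qed (simp_all add: filt_add filt_scale)

lemma leads_filt:
  assumes "leads T w" "w \<in> words" "x \<in> filt (Suc d)"
  shows "T x \<in> filt (Suc (d + length w))"
  using filt_add[OF above_filt[OF assms(1)[unfolded leads_def] assms(3)]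
      word_ad_filt[OF assms(2,3), simplified]] by simp

lemma word_above_comp:
  assumes "v \<in> words" "leads T w" "w \<in> words"
  shows "(\<lambda>x. word_ad v (T x) - word_ad (v @ w) x) \<in> above (v @ w)"
proof -
  have eq: "word_ad v (T x) - word_ad v (word_ad w x) = word_ad v (T x - word_ad w x)" for x
    using word_ad_add[of v "T x - word_ad w x" "word_ad w x"] by simp
  show ?thesis
    using above_comp_word_left[OF assms(2)[unfolded leads_def] assms(1)]
    by (simp add: word_ad_append eq)
qed

lemma above_comp_leads:
  assumes "S \<in> above v" "leads T w" "w \<in> words"
  shows "(\<lambda>x. S (T x)) \<in> above (v @ w)"
  using assms(1)
proof induction
  case (low S)
  have "(\<lambda>x. S (T x)) \<in> low (length v + length w)"
    using low leads_filt[OF assms(2,3)] by (rule low_comp_right)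
  then show ?case by (intro above.low) simp
next
  case (word u)
  have "v @ w < u @ w" using word by (intro append_less_append_of_less) auto
  then have "word_ad (u @ w) \<in> above (v @ w)"
    and "(\<lambda>x. word_ad u (T x) - word_ad (u @ w) x) \<in> above (v @ w)"
    using word assms(3) above_antimono[OF word_above_comp[OF word(1) assms(2,3)]]
    by (auto intro!: above.word)
  from above.add[OF this] show ?case by simp
next
  case (add S S')
  then show ?case by (intro above.add)
next
  case (scale S c)
  then show ?case by (intro above.scale)
qed

text \<open>Lexicographic order on words of equal length is compatible with concatenation, so leading
  words multiply.\<close>

lemma leads_comp:
  assumes "leads S v" "leads T w" "v \<in> words" "w \<in> words"
  shows "leads (\<lambda>x. S (T x)) (v @ w)"
  using above.add[OF above_comp_leads[OF assms(1)[unfolded leads_def] assms(2,4)]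
      word_above_comp[OF assms(3,2,4)]]
  by (simp add: leads_def)

text \<open>Every Lyndon word is the leading word of a sandwich monomial. Splitting \<open>u = v @ w\<close> into
  Lyndon words, the bracket of the monomials for \<open>v\<close> and \<open>w\<close> acts as a commutator whose two products
  have leading words \<open>v @ w\<close> and \<open>w @ v\<close>, and the second is larger.\<close>

lemma lyndon_sandwich:
  assumes "lyndon u" "u \<in> words"
  shows "\<exists>b. sandwich (length u) b \<and> leads (bracket b) u"
  using assms
proof (induction "length u" arbitrary: u rule: less_induct)
  case less
  show ?case
  proof (cases "length u = 1")
    case True
    then obtain i where "u = [i]" by (metis One_nat_def length_0_conv length_Suc_conv)
    then show ?thesis using less.prems sandwich_generator leads_generator by auto
  next
    case False
    then obtain v w where vw: "u = v @ w" "lyndon v" "lyndon w" "u < w @ v"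
      using lyndon_factorization less.prems(1) by blast
    then have pos: "0 < length v" "0 < length w" by (auto simp: lyndon_def)
    have words: "v \<in> words" "w \<in> words" using less.prems(2) vw by auto
    obtain b c where b: "sandwich (length v) b" "leads (bracket b) v"
      and c: "sandwich (length w) c" "leads (bracket c) w"
      using less.hyps[of v] less.hyps[of w] vw pos words by auto
    have "sandwich (length u) (bracket b c)"
      using sandwich_bracket[OF b(1) c(1) pos] vw by simp
    moreover have "leads (bracket (bracket b c)) u"
    proof -
      have "(\<lambda>x. bracket c (bracket b x) - word_ad (w @ v) x) \<in> above u"
        using leads_comp[OF c(2) b(2) words(2,1)] vw
        by (auto simp: leads_def intro: above_antimono)
      moreover have "word_ad (w @ v) \<in> above u"
        using vw words by (intro above.word) auto
      ultimately have cb: "(\<lambda>x. bracket c (bracket b x)) \<in> above u"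
        using above.add by fastforce
      have bc: "(\<lambda>x. bracket b (bracket c x) - word_ad u x) \<in> above u"
        using leads_comp[OF b(2) c(2) words] vw by (simp add: leads_def)
      from above_diff[OF bc cb] show ?thesis by (simp add: leads_def bracket_bracket algebra_simps)
    qed
    ultimately show ?thesis by blast
  qed
qed

section \<open>Finiteness of the normal words\<close>

definition normal_words :: "nat list set"
  where "normal_words = {w \<in> words. word_ad w \<notin> above w}"

lemma not_normal_if_low:
  assumes "leads T w" "T \<in> low (length w)"
  shows "w \<notin> normal_words"
proof -
  have "(\<lambda>x. T x - (T x - word_ad w x)) \<in> above w"
    using above_diff[OF above.low[OF assms(2)] assms(1)[unfolded leads_def]] .
  then show ?thesis by (simp add: normal_words_def)
qed

lemma factor_closed_normal_words: "factor_closed normal_words"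
  unfolding factor_closed_def
proof (intro ballI allI impI)
  fix w v assume w: "w \<in> normal_words" and "sublist v w"
  then obtain a b where ab: "w = a @ v @ b" by (auto simp: sublist_def)
  then have words: "a \<in> words" "v \<in> words" "b \<in> words" using w by (auto simp: normal_words_def)
  have "word_ad w \<in> above w" if "word_ad v \<in> above v"
    using above_comp_word_left[OF above_comp_leads[OF that leads_word_ad words(3)] words(1)] ab
    by (simp add: word_ad_append[abs_def])
  then show "v \<in> normal_words" using w words by (auto simp: normal_words_def)
qed

text \<open>With \<open>B\<close> the adjoint map of the sandwich led by the Lyndon word \<open>u\<close> and \<open>Y\<close> that of the
  generator \<open>y\<close>, the operators \<open>B B\<close>, \<open>B Y B\<close> and \<open>Y B Y\<close> are low. Hence their leading words
  \<open>u u\<close>, \<open>u y u\<close> and \<open>y u y\<close> are not normal, and the theorem on words applies.\<close>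

lemma finite_normal_words: "finite normal_words"
proof (rule finite_sandwich_free_language)
  show "finite {..<m}" "normal_words \<subseteq> words" "factor_closed normal_words"
    using factor_closed_normal_words by (auto simp: normal_words_def)
next
  fix u :: "nat list" assume "lyndon u"
  then have "u \<in> words \<Longrightarrow> \<exists>b. sandwich (length u) b \<and> leads (bracket b) u"
    and pos: "0 < length u"
    using lyndon_sandwich by (auto simp: lyndon_def)
  then obtain b where b: "u \<in> words \<Longrightarrow> sandwich (length u) b" "u \<in> words \<Longrightarrow> leads (bracket b) u"
    by blast
  show "u @ u \<notin> normal_words"
  proof
    assume *: "u @ u \<in> normal_words"
    then have u: "u \<in> words" by (auto simp: normal_words_def)
    have "(\<lambda>x. bracket b (bracket b x)) \<in> low (length (u @ u))"
      using b(1)[OF u] by (simp add: sandwich_def mult_2)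
    then show False
      using not_normal_if_low[OF leads_comp[OF b(2) b(2)]] u * by blast
  qed
  show "u @ [y] @ u \<notin> normal_words" for y
  proof
    assume *: "u @ [y] @ u \<in> normal_words"
    then have u: "u \<in> words" and y: "y < m" by (auto simp: normal_words_def)
    have "(\<lambda>x. bracket b (bracket (e y) (bracket b x))) \<in> low (length (u @ [y] @ u))"
      using sandwich_middle[OF b(1)[OF u], of "e y" 1] sandwich_generator[OF y]
      by (simp add: sandwich_def mult_2)
    moreover have "leads (\<lambda>x. bracket b (bracket (e y) (bracket b x))) (u @ [y] @ u)"
      using b(2)[OF u] u y by (intro leads_comp leads_generator) auto
    ultimately show False using not_normal_if_low * by blast
  qed
  show "[y] @ u @ [y] \<notin> normal_words" for y
  proof
    assume *: "[y] @ u @ [y] \<in> normal_words"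
    then have u: "u \<in> words" and y: "y < m" by (auto simp: normal_words_def)
    have "(\<lambda>x. bracket (e y) (bracket b (bracket (e y) x))) \<in> low (length ([y] @ u @ [y]))"
      using sandwich_middle[OF sandwich_generator[OF y], of b "length u"] b(1)[OF u] pos
      by (simp add: sandwich_def)
    moreover have "leads (\<lambda>x. bracket (e y) (bracket b (bracket (e y) x))) ([y] @ u @ [y])"
      using b(2)[OF u] u y by (intro leads_comp leads_generator) auto
    ultimately show False using not_normal_if_low * by blast
  qed
qed

text \<open>If no word of length \<open>n\<close> is normal, each can be replaced by larger ones of that length, of
  which there are finitely many; the process ends in low operators.\<close>

lemma long_words_low:
  assumes "\<And>u. u \<in> normal_words \<Longrightarrow> length u \<noteq> n" and "u \<in> words" "length u = n"
  shows "word_ad u \<in> low n"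
proof (rule ccontr)
  define Z where "Z = {v \<in> words. length v = n \<and> word_ad v \<notin> low n}"
  assume "word_ad u \<notin> low n"
  then have "Z \<noteq> {}" using assms by (auto simp: Z_def)
  moreover have "Z \<subseteq> {xs. set xs \<subseteq> {..<m} \<and> length xs = n}" by (auto simp: Z_def)
  then have "finite Z" using finite_lists_length_eq[of "{..<m}" n] finite_subset by blast
  ultimately have Max: "Max Z \<in> Z" "\<And>v. v \<in> Z \<Longrightarrow> v \<le> Max Z" by auto
  have "T \<in> low n" if "T \<in> above (Max Z)" for T
    using that
  proof induction
    case (word v)
    then have "v \<notin> Z" using Max(2)[of v] by auto
    then show ?case using word Max(1) by (simp add: Z_def)
  qed (use Max(1) in \<open>auto simp: Z_def low_add low_scale\<close>)
  then have "Max Z \<in> normal_words" using Max(1) by (auto simp: Z_def normal_words_def)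
  then show False using assms(1) Max(1) by (auto simp: Z_def)
qed

text \<open>A monomial of length above \<open>n\<close> begins with a word of length \<open>n\<close>, which acts as a low
  operator, so the monomial is a combination of shorter ones.\<close>

lemma filt_stabilizes: "\<exists>n. \<forall>d. filt d \<subseteq> filt n"
proof -
  have "finite (length ` normal_words)" using finite_normal_words by simp
  then obtain n where n: "n \<notin> length ` normal_words" using ex_new_if_finite[OF infinite_UNIV_nat] by blast
  then have long: "word_ad u \<in> low n" if "u \<in> words" "length u = n" for u
    using long_words_low[OF _ that] by auto
  have step: "filt (Suc (d + n)) \<subseteq> filt (d + n)" for d
  proof
    fix x assume "x \<in> filt (Suc (d + n))"
    then show "x \<in> filt (d + n)"
    proof (induction rule: filt_induct)
      case subspace
      show ?case using subspace_filt by simp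
    next
      case (word w i)
      show ?case
      proof (cases "length w < d + n")
        case True
        then show ?thesis using word word_in_filt by simp
      next
        case False
        then have len: "length w = d + n" using word by simp
        have split: "take n w \<in> words" "drop n w \<in> words"
          using word by (auto dest: in_set_takeD in_set_dropD)
        have "word_ad (drop n w) (e i) \<in> filt (Suc d)"
          using split word len by (intro word_in_filt) auto
        then have "word_ad (take n w) (word_ad (drop n w) (e i)) \<in> filt (d + n)"
          using lowD[OF long] split len by simp
        then show ?thesis by (simp flip: word_ad_append)
      qed
    qed
  qed
  have "filt (d + n) \<subseteq> filt n" for d
    by (induction d) (use step in auto)
  then have "filt d \<subseteq> filt n" for d
    using filt_mono[of d "d + n"] by fastforce
  then show ?thesis by blast
qed

theorem lie_generated_finite_span: "\<exists>B. finite B \<and> lie_generated (e ` {..<m}) \<subseteq> span B"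
proof -
  obtain n where n: "\<And>d. filt d \<subseteq> filt n" using filt_stabilizes by blast
  define B where "B = {word_ad w (e i) | w i. w \<in> words \<and> i < m \<and> length w < n}"
  have "B \<subseteq> (\<lambda>(w, i). word_ad w (e i)) ` ({w. set w \<subseteq> {..<m} \<and> length w \<le> n} \<times> {..<m})"
    by (auto simp: B_def image_iff)
  then have "finite B"
    by (rule finite_subset) (intro finite_imageI finite_cartesian_product finite_lists_length_le finite_lessThan)
  moreover have "lie_generated (e ` {..<m}) \<subseteq> filt n"
    unfolding lie_generated_def
    \<comment> \<open>The filtration is multiplicative and stops growing at \<open>n\<close>, so \<open>filt n\<close> is a subalgebra.\<close>
  proof (rule hull_minimal)
    show "e ` {..<m} \<subseteq> filt n"
      using sandwich_generator n[of 1] by (auto simp: sandwich_def)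
    show "lie_subalgebra (filt n)"
      unfolding lie_subalgebra_def using subspace_filt bracket_filt n by blast
  qed
  ultimately show ?thesis unfolding filt_def B_def by blast
qed

end

section \<open>Lie algebras generated by extremal elements\<close>

theorem theorem4p1:
  fixes scale :: "'k::field \<Rightarrow> 'l::ab_group_add \<Rightarrow> 'l"
    and bracket :: "'l \<Rightarrow> 'l \<Rightarrow> 'l"
  assumes "CHAR('k) \<noteq> 2"
    and "lie_algebra scale bracket"
    and "\<exists>E. finite E \<and> (\<forall>x\<in>E. lie_algebra.extremal scale bracket x) \<and>
           lie_algebra.lie_generated scale bracket E = UNIV"
  shows "\<exists>B. finite_dimensional_vector_space scale B"
proof -
  interpret lie_algebra scale bracket by (rule assms(2))
  obtain E where E: "finite E" "\<And>x. x \<in> E \<Longrightarrow> extremal x" "lie_generated E = UNIV"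
    using assms(3) by blast
  obtain m :: nat and e where e: "E = e ` {i. i < m}"
    using finite_imp_nat_seg_image_inj_on[OF E(1)] by blast
  have "CHAR('k) \<noteq> 1" by simp
  have "\<not> CHAR('k) dvd 2"
  proof
    assume dvd: "CHAR('k) dvd 2"
    then have "CHAR('k) \<le> 2" by (simp add: dvd_imp_le)
    then have "CHAR('k) = 0" using assms(1) \<open>CHAR('k) \<noteq> 1\<close> by linarith
    then show False using dvd by simp
  qed
  then have "of_nat 2 \<noteq> (0::'k)" by (simp only: of_nat_eq_0_iff_char_dvd) simp
  then interpret extremal_generators scale bracket e m
    using E(2) e by unfold_locales auto
  obtain C where C: "finite C" "span C = UNIV"
    using lie_generated_finite_span E(3) e by (auto simp: lessThan_def)
  obtain B where B: "B \<subseteq> C" "independent B" "C \<subseteq> span B"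
    using maximal_independent_subset by blast
  then have "span B = UNIV" using C(2) span_minimal[OF B(3)] by auto
  then have "finite_dimensional_vector_space scale B"
    using B C(1) finite_subset by unfold_locales auto
  then show ?thesis by blast
qed

end
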